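(* For any prime $p\equiv 1\pmod 4$, we have $$\left(\frac{\sqrt{D_p^{(3)}}}{p}\right)=(-1)^{\left|\left\{0<k<\frac p4:\ \left(\frac kp\right)=-1\right\}\right|}\left(\frac{p}{4+(-1)^{(p-1)/4}}\right),$$ where $k$ ranges over integers.
   Context: For an odd prime $p$, $$D_p^{(3)}=\det\left[(i^2-j^2)^3\left(\frac{i^2-j^2}{p}\right)\right]_{1\le i,j\le (p-1)/2},$$ where $\left(\frac{\cdot}{p}\right)$ is the Legendre symbol modulo $p$ (equal to $0$ on multiples of $p$). When $p\equiv 1\pmod 4$, the matrix is an integer skew-symmetric matrix of even order, so by Cayley's theorem $D_p^{(3)}$ is the square of an integer; $\sqrt{D_p^{(3)}}$ denotes its (nonnegative) integer square root. The number $4+(-1)^{(p-1)/4}$ is $5$ or $3$, and the last symbol is the Legendre symbol modulo that prime. *)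

theory Defs
  imports
    "HOL-Number_Theory.Quadratic_Reciprocity"
    "Jordan_Normal_Form.Determinant"
begin

(* Matrices of Jordan_Normal_Form are indexed from 0, hence the shift of the row
   and column indices i, j = 1, ..., (p-1)/2. *)
definition D3_mat :: "nat \<Rightarrow> int mat" where
  "D3_mat p = mat ((p - 1) div 2) ((p - 1) div 2)
     (\<lambda>(i, j). ((int (i + 1))^2 - (int (j + 1))^2)^3
               * Legendre ((int (i + 1))^2 - (int (j + 1))^2) (int p))"

definition D3 :: "nat \<Rightarrow> int" where
  "D3 p = Determinant.det (D3_mat p)"

(* The nonnegative integer square root; unspecified unless a is the square of an
   integer. *)
definition int_sqrt :: "int \<Rightarrow> int" where
  "int_sqrt a = (THE s. 0 \<le> s \<and> s^2 = a)"

end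

theory Submission
  imports
    Defs
    "HOL-Number_Theory.Residue_Primitive_Roots"
begin

text \<open>
  Write \<open>p = 4 h + 1\<close>, \<open>n = 2 h\<close> and \<open>x\<^sub>i = i\<^sup>2\<close>. By Euler's criterion the matrix entries are
  congruent to \<open>(x\<^sub>i - x\<^sub>j)\<^bsup>n+3\<^esup>\<close>, and since \<open>x\<^sub>i\<^sup>n = 1\<close> modulo \<open>p\<close>, expanding the binomial
  factors the matrix as \<open>V\<^sup>T C V\<close> with \<open>V\<close> a Vandermonde matrix and \<open>C\<close> a monomial skew-symmetric
  matrix of binomial coefficients. Hence the square root of the determinant is, up to sign,
  \<open>det V\<close> times the Pfaffian of \<open>C\<close>, and the sign is irrelevant because \<open>-1\<close> is a quadratic residue.
  The Legendre symbol of \<open>det V\<close> follows from \<open>V V\<^sup>T\<close>, which consists of power sums; that of the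
  Pfaffian follows from Wilson's theorem and \<open>n = -1/2\<close>. For \<open>p = 5\<close> the exponents \<open>0, ..., n+3\<close>
  wrap around more than once modulo \<open>n\<close>, and this case is computed directly.
\<close>

section \<open>Determinants\<close>

text \<open>The rows and the columns each contribute \<open>signof q\<close>, and these two signs
  cancel.\<close>

lemma det_permute_rows_cols:
  assumes A: "A \<in> carrier_mat n n" and q: "q permutes {0..<n}"
  shows "Determinant.det (mat n n (\<lambda>(i, j). A $$ (q i, q j))) = Determinant.det A"
proof -
  define B where "B = mat n n (\<lambda>(i, j). A $$ (q i, j))"
  have B: "B \<in> carrier_mat n n" by (simp add: B_def)
  have lt: "q i < n" if "i < n" for i
    using permutes_in_image[OF q, of i] that by simp
  have eq: "mat n n (\<lambda>(i, j). A $$ (q i, q j)) = transpose_mat (mat n n (\<lambda>(i, j). transpose_mat B $$ (q i, j)))"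
    by (rule eq_matI) (auto simp: B_def lt)
  have "Determinant.det (mat n n (\<lambda>(i, j). A $$ (q i, q j)))
      = Determinant.det (mat n n (\<lambda>(i, j). transpose_mat B $$ (q i, j)))"
    unfolding eq by (rule det_transpose[of _ n]) simp
  also have "\<dots> = signof q * Determinant.det (transpose_mat B)"
    by (rule det_permute_rows[OF _ q]) (simp add: B)
  also have "\<dots> = signof q * Determinant.det B"
    by (simp add: det_transpose[OF B])
  also have "\<dots> = signof q * (signof q * Determinant.det A)"
    unfolding B_def by (subst det_permute_rows[OF A q]) simp
  finally show ?thesis by (simp flip: mult.assoc of_int_mult)
qed

section \<open>Cayley's theorem for skew-symmetric determinants\<close>

lemma det_mat_2:
  fixes A :: "'a :: comm_ring_1 mat"
  assumes A: "A \<in> carrier_mat 2 2"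
  shows "Determinant.det A = A $$ (0, 0) * A $$ (1, 1) - A $$ (0, 1) * A $$ (1, 0)"
proof -
  have single: "Determinant.det (mat (Suc 0) (Suc 0) f) = f (0, 0)" for f :: "nat \<times> nat \<Rightarrow> 'a"
    by (subst det_single) simp_all
  have dim: "dim_row A = 2" "dim_col A = 2" using A by auto
  have "Determinant.det A = (\<Sum>i<2. A $$ (i, 0) * cofactor A i 0)"
    by (rule laplace_expansion_column[OF A]) simp
  then show ?thesis
    by (simp add: numeral_2_eq_2 cofactor_def single mat_delete_def dim)
qed

text \<open>Strong induction on the size: a nonzero entry of row 0 is moved to position (0, 1), and
  the 2 by 2 block it creates is split off by block elimination. The zero diagonal is assumed
  separately because the field may have characteristic 2.\<close>

lemma det_skew_symmetric_is_square:
  fixes A :: "'a :: field mat"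
  assumes "A \<in> carrier_mat n n"
    and "\<And>i j. i < n \<Longrightarrow> j < n \<Longrightarrow> A $$ (i, j) = - A $$ (j, i)"
    and "\<And>i. i < n \<Longrightarrow> A $$ (i, i) = 0"
  shows "\<exists>x. Determinant.det A = x ^ 2"
  using assms
proof (induction n arbitrary: A rule: less_induct)
  case (less n A)
  show ?case
  proof (cases "\<exists>j<n. A $$ (0, j) \<noteq> 0")
    case False
    show ?thesis
    proof (cases "n = 0")
      case True
      then show ?thesis using less.prems(1) by (intro exI[of _ 1]) simp
    next
      case n: False
      have "(\<Prod>i = 0..<n. A $$ (i, q i)) = 0" if q: "q permutes {0..<n}" for q
        using False n permutes_in_image[OF q, of 0] by (intro prod_zero) auto
      then have "Determinant.det A = 0"
        unfolding det_def'[OF less.prems(1)] by (intro sum.neutral) simp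
      then show ?thesis by (intro exI[of _ 0]) simp
    qed
  next
    case True
    then obtain j where j: "j < n" "A $$ (0, j) \<noteq> 0" by blast
    have j0: "j \<noteq> 0"
    proof
      assume "j = 0"
      then show False using j less.prems(3)[of 0] by simp
    qed
    define m where "m = n - 2"
    have n: "n = 2 + m" using j(1) j0 by (simp add: m_def)
    \<comment> \<open>Since \<open>j \<noteq> 0\<close>, this swap fixes index 0 and brings the
      nonzero entry to position (0, 1).\<close>
    define q where "q = transpose 1 j"
    have q: "q permutes {0..<n}"
      unfolding q_def by (rule permutes_swap_id) (use j n in auto)
    have qlt: "q i < n" if "i < n" for i
      using permutes_in_image[OF q, of i] that by simp
    define B where "B = mat n n (\<lambda>(i, j). A $$ (q i, q j))"
    have detB: "Determinant.det B = Determinant.det A"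
      unfolding B_def by (rule det_permute_rows_cols[OF less.prems(1) q])
    have skew: "B $$ (k, l) = - B $$ (l, k)" if "k < n" "l < n" for k l
      using less.prems(2)[OF qlt[OF that(1)] qlt[OF that(2)]] that by (simp add: B_def)
    have diag: "B $$ (k, k) = 0" if "k < n" for k
      using less.prems(3)[OF qlt[OF that]] that by (simp add: B_def)
    define a where "a = B $$ (0, 1)"
    have a: "a \<noteq> 0"
      using j j0 n by (simp add: a_def B_def q_def transpose_def)
    define P where "P = mat 2 2 (\<lambda>(k, l). B $$ (k, l))"
    define Q where "Q = mat 2 m (\<lambda>(k, l). B $$ (k, l + 2))"
    define R where "R = mat m 2 (\<lambda>(k, l). B $$ (k + 2, l))"
    define T where "T = mat m m (\<lambda>(k, l). B $$ (k + 2, l + 2))"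
    \<comment> \<open>\<open>E\<close> is minus \<open>R\<close> times the inverse of
      \<open>P\<close>, written out for \<open>P\<close> with rows (0, a) and (-a, 0).\<close>
    define E where "E = mat m 2 (\<lambda>(k, l). if l = 0 then - B $$ (k + 2, 1) / a else B $$ (k + 2, 0) / a)"
    (* S is the Schur complement of the invertible block P; it is again skew-symmetric. *)
    define S where "S = mat m m (\<lambda>(k, l). B $$ (k + 2, l + 2)
        - B $$ (k + 2, 1) / a * B $$ (0, l + 2) + B $$ (k + 2, 0) / a * B $$ (1, l + 2))"
    have carr: "P \<in> carrier_mat 2 2" "Q \<in> carrier_mat 2 m" "R \<in> carrier_mat m 2"
      "T \<in> carrier_mat m m" "E \<in> carrier_mat m 2" "S \<in> carrier_mat m m"
      by (simp_all add: P_def Q_def R_def T_def E_def S_def)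
    have B: "B = four_block_mat P Q R T"
    proof (rule eq_matI)
      fix k l assume "k < dim_row (four_block_mat P Q R T)" "l < dim_col (four_block_mat P Q R T)"
      moreover have "Suc (Suc (i - 2)) = i" if "\<not> i < 2" for i :: nat
        using that by simp
      ultimately show "B $$ (k, l) = four_block_mat P Q R T $$ (k, l)"
        by (simp add: P_def Q_def R_def T_def)
    qed (simp_all add: B_def P_def T_def n)
    have B01: "B $$ (0, Suc 0) = a" by (simp add: a_def)
    have B10: "B $$ (Suc 0, 0) = - a" using skew[of 1 0] n by (simp add: a_def)
    have ER: "E * P + 1\<^sub>m m * R = 0\<^sub>m m 2"
    proof (rule eq_matI)
      fix k l assume "k < dim_row (0\<^sub>m m 2)" "l < dim_col (0\<^sub>m m 2)"
      then have kl: "k < m" "l < 2" by auto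
      then consider "l = 0" | "l = 1" by linarith
      then show "(E * P + 1\<^sub>m m * R) $$ (k, l) = 0\<^sub>m m 2 $$ (k, l)"
        using kl a diag[of 0] diag[of 1] n carr
        by cases (simp_all add: E_def P_def R_def scalar_prod_def numeral_2_eq_2 B10 B01)
    qed (use carr in auto)
    have ES: "E * Q + 1\<^sub>m m * T = S"
      by (rule eq_matI) (use carr in \<open>auto simp: E_def Q_def T_def S_def scalar_prod_def numeral_2_eq_2\<close>)
    \<comment> \<open>Multiplying by this unitriangular matrix clears the block below
      \<open>P\<close> and keeps the determinant.\<close>
    define L where "L = four_block_mat (1\<^sub>m 2) (0\<^sub>m 2 m) E (1\<^sub>m m)"
    have "L * B = four_block_mat (1\<^sub>m 2 * P + 0\<^sub>m 2 m * R) (1\<^sub>m 2 * Q + 0\<^sub>m 2 m * T)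
        (E * P + 1\<^sub>m m * R) (E * Q + 1\<^sub>m m * T)"
      unfolding L_def B by (rule mult_four_block_mat) (use carr in auto)
    also have "\<dots> = four_block_mat P Q (0\<^sub>m m 2) S"
      unfolding ER ES using carr by simp
    finally have LB: "L * B = four_block_mat P Q (0\<^sub>m m 2) S" .
    have "Determinant.det L = 1"
      unfolding L_def by (subst det_four_block_mat_upper_right_zero) (use carr in auto)
    moreover have "Determinant.det (L * B) = Determinant.det L * Determinant.det B"
      by (rule det_mult[of _ n]) (use carr in \<open>auto simp: L_def B_def n\<close>)
    moreover have "Determinant.det (L * B) = Determinant.det P * Determinant.det S"
      unfolding LB by (rule det_four_block_mat_lower_left_zero) (use carr in auto)
    moreover have "Determinant.det P = a ^ 2"
    proof -
      have "Determinant.det P = P $$ (0,0) * P $$ (1,1) - P $$ (0,1) * P $$ (1,0)"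
        by (rule det_mat_2[OF carr(1)])
      then show ?thesis
        using diag[of 0] n by (simp add: P_def B10 B01 power2_eq_square)
    qed
    moreover obtain x where "Determinant.det S = x ^ 2"
    proof -
      have "\<exists>x. Determinant.det S = x ^ 2"
      proof (rule less.IH[of m])
        show "S $$ (k, l) = - S $$ (l, k)" if "k < m" "l < m" for k l
          using that skew[of "k + 2" "l + 2"] skew[of "k + 2" 0] skew[of "k + 2" 1]
            skew[of 0 "l + 2"] skew[of 1 "l + 2"] n
          by (simp add: S_def field_simps)
        show "S $$ (k, k) = 0" if "k < m" for k
          using that diag[of "k + 2"] skew[of "k + 2" 0] skew[of "k + 2" 1] n
          by (simp add: S_def)
      qed (use carr n in auto)
      then show ?thesis using that by blast
    qed
    ultimately have "Determinant.det A = (a * x) ^ 2"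
      by (simp add: detB power_mult_distrib)
    then show ?thesis by blast
  qed
qed

text \<open>If \<open>a / b\<close> squares to an integer, then \<open>b ^ 2\<close> divides
  \<open>a ^ 2\<close>, hence \<open>b\<close> divides \<open>a\<close>.\<close>

lemma int_square_if_rat_square:
  assumes "rat_of_int d = x ^ 2"
  shows "\<exists>y. d = y ^ 2"
proof -
  obtain a b where ab: "x = of_int a / of_int b" "b > 0"
    by (metis quotient_of_denom_pos quotient_of_div surj_pair)
  with assms have "rat_of_int (d * b ^ 2) = rat_of_int (a ^ 2)"
    by (simp add: field_simps)
  then have eq: "d * b ^ 2 = a ^ 2" by (simp only: of_int_eq_iff)
  then have "b ^ 2 dvd a ^ 2" by (metis dvd_triv_right)
  then have "b dvd a" by simp
  then obtain y where "a = b * y" by blast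
  with eq ab(2) have "d = y ^ 2" by (simp add: power_mult_distrib)
  then show ?thesis by blast
qed

text \<open>The elimination divides by entries, so it is carried out over the rationals and the root
  is brought back to the integers.\<close>

lemma int_det_skew_symmetric_is_square:
  fixes A :: "int mat"
  assumes A: "A \<in> carrier_mat n n"
    and skew: "\<And>i j. i < n \<Longrightarrow> j < n \<Longrightarrow> A $$ (i, j) = - A $$ (j, i)"
  shows "\<exists>x. Determinant.det A = x ^ 2"
proof -
  interpret c: comm_ring_hom "of_int :: int \<Rightarrow> rat"
    by unfold_locales auto
  have dim: "dim_row A = n" "dim_col A = n" using A by auto
  have "\<exists>x. Determinant.det (map_mat rat_of_int A) = x ^ 2"
  proof (rule det_skew_symmetric_is_square)
    show "map_mat rat_of_int A $$ (i, j) = - map_mat rat_of_int A $$ (j, i)" if "i < n" "j < n" for i j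
      using skew[OF that] that dim by simp
    show "map_mat rat_of_int A $$ (i, i) = 0" if "i < n" for i
      using skew[OF that that] that dim by simp
  qed (use A in auto)
  then obtain x where "rat_of_int (Determinant.det A) = x ^ 2" by auto
  then show ?thesis by (rule int_square_if_rat_square)
qed

text \<open>In the Leibniz formula every permutation other than \<open>q\<close> meets a zero
  entry.\<close>

lemma det_monomial_mat:
  fixes c :: "nat \<Rightarrow> 'a :: comm_ring_1"
  assumes q: "q permutes {0..<n}"
  shows "Determinant.det (mat n n (\<lambda>(i, j). if j = q i then c i else 0)) = signof q * (\<Prod>i<n. c i)"
proof -
  let ?A = "mat n n (\<lambda>(i, j). if j = q i then c i else 0)"
  have lt: "r i < n" if "r permutes {0..<n}" "i < n" for r i
    using permutes_in_image[OF that(1), of i] that(2) by simp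
  have zero: "(\<Prod>i = 0..<n. ?A $$ (i, r i)) = 0" if r: "r permutes {0..<n}" "r \<noteq> q" for r
  proof -
    obtain i where i: "r i \<noteq> q i" using r(2) by blast
    then have "i < n"
      using r(1) q by (metis atLeastLessThan_iff permutes_not_in zero_le)
    then show ?thesis using i lt[OF r(1)] by (intro prod_zero) auto
  qed
  have "Determinant.det ?A = (\<Sum>r | r permutes {0..<n}. signof r * (\<Prod>i = 0..<n. ?A $$ (i, r i)))"
    by (rule det_def') simp
  also have "\<dots> = (\<Sum>r | r permutes {0..<n}. if r = q then signof q * (\<Prod>i<n. c i) else 0)"
    using zero lt[OF q] by (intro sum.cong) (auto simp: atLeast0LessThan)
  also have "\<dots> = signof q * (\<Prod>i<n. c i)"
    using q by (simp add: finite_permutations)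
  finally show ?thesis .
qed

lemma cong_det:
  fixes A B :: "int mat"
  assumes A: "A \<in> carrier_mat n n" and B: "B \<in> carrier_mat n n"
    and AB: "\<And>i j. i < n \<Longrightarrow> j < n \<Longrightarrow> [A $$ (i, j) = B $$ (i, j)] (mod m)"
  shows "[Determinant.det A = Determinant.det B] (mod m)"
  unfolding det_def'[OF A] det_def'[OF B]
proof (intro cong_sum cong_mult cong_refl cong_prod)
  fix r i assume "r \<in> {r. r permutes {0..<n}}" "i \<in> {0..<n}"
  then show "[A $$ (i, r i) = B $$ (i, r i)] (mod m)"
    using permutes_in_image[of r "{0..<n}" i] by (auto intro!: AB)
qed

section \<open>Reversals of intervals and their signs\<close>

definition segment_rev :: "nat \<Rightarrow> nat \<Rightarrow> nat \<Rightarrow> nat" where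
  "segment_rev a m i = (if a \<le> i \<and> i < a + m then 2 * a + m - 1 - i else i)"

lemma segment_rev_permutes: "segment_rev a m permutes {a..<a + m}"
  by (rule bij_imp_permutes, rule bij_betwI[where g = "segment_rev a m"])
     (auto simp: segment_rev_def)

text \<open>Splitting off the swap of the two end points gives the induction step for the
  sign.\<close>

lemma segment_rev_Suc_Suc:
  "segment_rev a (Suc (Suc m)) = transpose a (a + m + 1) \<circ> segment_rev (Suc a) m"
  by (auto simp: fun_eq_iff segment_rev_def transpose_def)

lemma permutation_segment_rev: "permutation (segment_rev a m)"
  using segment_rev_permutes permutation_permutes by blast

text \<open>A reversal is a product of \<open>m div 2\<close> swaps of opposite positions. Both the
  Gram matrix of \<open>vmat\<close> and \<open>cmat\<close> have a pattern built from
  reversals.\<close>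

lemma sign_segment_rev: "sign (segment_rev a m) = (-1) ^ (m div 2)"
proof (induction m arbitrary: a rule: nat_less_induct)
  case (1 m)
  consider "m = 0" | "m = 1" | k where "m = Suc (Suc k)"
    by (metis One_nat_def not0_implies_Suc)
  then show ?case
  proof cases
    case 1
    have "segment_rev a 0 = id" by (auto simp: segment_rev_def)
    then show ?thesis using 1 by simp
  next
    case 2
    have "segment_rev a (Suc 0) = id" by (rule ext) (auto simp: segment_rev_def)
    then show ?thesis using 2 by simp
  next
    case (3 k)
    then have "sign (segment_rev (Suc a) k) = (-1) ^ (k div 2)" using "1.IH" by simp
    then show ?thesis
      unfolding 3 segment_rev_Suc_Suc
      by (subst sign_compose) (auto simp: permutation_swap_id permutation_segment_rev sign_swap_id)
  qed
qed

section \<open>Legendre symbols and power sums\<close>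

text \<open>The upper half of the range is traversed backwards; this matches the symmetry between
  \<open>k\<close> and \<open>N - k\<close> of binomial coefficients.\<close>

lemma prod_pair_ends:
  fixes f :: "nat \<Rightarrow> 'a :: comm_monoid_mult"
  shows "(\<Prod>k<2 * m. f k) = (\<Prod>k<m. f k * f (2 * m - 1 - k))"
proof -
  have "(\<Prod>k<m + m. f k) = (\<Prod>k<m. f k) * (\<Prod>k = m..<m + m. f k)"
    by (subst prod.atLeastLessThan_concat[symmetric, of 0 m, simplified atLeast0LessThan])
       (simp_all add: atLeast0LessThan)
  also have "(\<Prod>k = m..<m + m. f k) = (\<Prod>k<m. f (m + k))"
    using prod.shift_bounds_nat_ivl[of f 0 m m] by (simp add: atLeast0LessThan add.commute)
  also have "\<dots> = (\<Prod>k<m. f (m + (m - Suc k)))"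
    by (rule prod.nat_diff_reindex[symmetric])
  also have "\<dots> = (\<Prod>k<m. f (2 * m - 1 - k))"
    by (intro prod.cong) (auto simp: Suc_diff_Suc intro!: arg_cong[of _ _ f])
  finally show ?thesis by (simp add: prod.distrib mult_2)
qed

lemma prod_pair_consecutive:
  fixes f :: "nat \<Rightarrow> 'a :: comm_monoid_mult"
  shows "(\<Prod>k<2 * m. f k) = (\<Prod>i<m. f (2 * i) * f (2 * i + 1))"
  by (induction m) (simp_all add: ac_simps)

lemma fact_double: "fact (2 * m) = 2 ^ m * fact m * (\<Prod>i<m. 2 * int i + 1)"
  by (induction m) (simp_all add: algebra_simps)

lemma Legendre_cong:
  assumes "[a = b] (mod m)"
  shows "Legendre a m = Legendre b m"
proof -
  have "[a = c] (mod m) \<longleftrightarrow> [b = c] (mod m)" "[c = a] (mod m) \<longleftrightarrow> [c = b] (mod m)" for c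
    using assms by (meson cong_sym cong_trans)+
  then show ?thesis by (simp add: Legendre_def QuadRes_def)
qed

lemma Legendre_eq_0_iff: "Legendre a m = 0 \<longleftrightarrow> m dvd a"
  by (simp add: Legendre_def cong_0_iff)

lemma Legendre_square:
  assumes "prime m" "\<not> m dvd a"
  shows "Legendre (a ^ 2) m = 1"
proof -
  have "QuadRes m (a ^ 2)" unfolding QuadRes_def by (rule exI[of _ a]) simp
  moreover have "\<not> m dvd a ^ 2" using assms prime_dvd_power by blast
  ultimately show ?thesis by (simp add: Legendre_def cong_0_iff)
qed

lemma Legendre_cases: "Legendre a m \<in> {-1, 0, 1}"
  by (simp add: Legendre_def)

text \<open>Two values in {-1, 0, 1} differ by at most 2, so for \<open>p > 2\<close> a congruence
  between them is an equality.\<close>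

lemma Legendre_eqI:
  assumes "prime p" "2 < p" "[a ^ ((p - 1) div 2) = v] (mod int p)" "v \<in> {-1, 0, 1}"
  shows "Legendre a (int p) = v"
proof -
  have "[Legendre a (int p) = v] (mod int p)"
    using euler_criterion[OF assms(1,2)] assms(3) by (rule cong_trans)
  then have "int p dvd Legendre a (int p) - v"
    by (simp add: cong_iff_dvd_diff)
  moreover have "\<bar>Legendre a (int p) - v\<bar> < int p"
    using assms(2,4) Legendre_cases[of a "int p"] by auto
  ultimately show ?thesis
    by (metis dvd_imp_le_int eq_iff_diff_eq_0 abs_of_nat linorder_not_less)
qed

lemma Legendre_mult:
  assumes "prime p" "2 < p"
  shows "Legendre (a * b) (int p) = Legendre a (int p) * Legendre b (int p)"
proof (rule Legendre_eqI[OF assms])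
  have "[a ^ ((p - 1) div 2) * b ^ ((p - 1) div 2) = Legendre a (int p) * Legendre b (int p)] (mod int p)"
    by (intro cong_mult) (rule cong_sym, rule euler_criterion[OF assms])+
  then show "[(a * b) ^ ((p - 1) div 2) = Legendre a (int p) * Legendre b (int p)] (mod int p)"
    by (simp add: power_mult_distrib)
  show "Legendre a (int p) * Legendre b (int p) \<in> {-1, 0, 1}"
    using Legendre_cases[of a "int p"] Legendre_cases[of b "int p"] by auto
qed

text \<open>If \<open>p - 1\<close> divides \<open>m\<close>, all terms are 1 by Fermat. Otherwise a
  primitive root \<open>g\<close> turns the sum into a geometric series with ratio
  \<open>g ^ m\<close>, which is not 1 modulo \<open>p\<close>.\<close>

lemma sum_powers_mod_prime:
  assumes p: "prime p"
  shows "[(\<Sum>a = 1..<p. int a ^ m) = (if p - 1 dvd m then -1 else 0)] (mod int p)"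
proof (cases "p - 1 dvd m")
  case True
  then obtain k where k: "m = (p - 1) * k" by blast
  have "[int a ^ m = 1] (mod int p)" if "a \<in> {1..<p}" for a
  proof -
    have "\<not> p dvd a" using that by (auto dest: dvd_imp_le)
    then have "[a ^ (p - 1) = 1] (mod p)" by (rule fermat_theorem[OF p])
    then have "[(a ^ (p - 1)) ^ k = 1 ^ k] (mod p)" by (rule cong_pow)
    then show ?thesis by (simp add: k power_mult flip: cong_int_iff)
  qed
  then have "[(\<Sum>a = 1..<p. int a ^ m) = (\<Sum>a = 1..<p. 1)] (mod int p)"
    by (rule cong_sum)
  also have "(\<Sum>a = 1..<p. 1) = int p - 1"
    using prime_gt_0_nat[OF p] by simp
  also have "[int p - 1 = -1] (mod int p)" by (simp add: cong_iff_dvd_diff)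
  finally show ?thesis using True by simp
next
  case False
  have p1: "p > 1" using p by (rule prime_gt_1_nat)
  obtain g where g: "residue_primroot p g"
    using prime_primitive_root_exists[OF p1 p] by blast
  have ord: "ord p g = p - 1"
    using g by (simp add: residue_primroot_def totient_prime p)
  have gp: "[int g ^ (p - 1) = 1] (mod int p)"
    using ord[symmetric] ord_divides[of g "p - 1" p] by (simp flip: cong_int_iff)
  have "(\<Sum>a = 1..<p. int a ^ m) = (\<Sum>a\<in>totatives p. int a ^ m)"
    using p p1 by (intro sum.cong) (auto simp: totatives_prime)
  also have "\<dots> = (\<Sum>i<p - 1. int (g ^ i mod p) ^ m)"
    using residue_primroot_is_generator[OF p1 g]
    by (subst sum.reindex_bij_betw[symmetric, where S = "{..<p - 1}"]) (simp_all add: totient_prime p)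
  finally have sum: "(\<Sum>a = 1..<p. int a ^ m) = (\<Sum>i<p - 1. int (g ^ i mod p) ^ m)" .
  have "[(\<Sum>i<p - 1. int (g ^ i mod p) ^ m) = (\<Sum>i<p - 1. (int g ^ m) ^ i)] (mod int p)"
  proof (rule cong_sum)
    fix i
    have "[int (g ^ i mod p) ^ m = (int g ^ i) ^ m] (mod int p)"
      by (intro cong_pow) (simp add: cong_def zmod_int)
    then show "[int (g ^ i mod p) ^ m = (int g ^ m) ^ i] (mod int p)"
      by (simp add: mult.commute flip: power_mult)
  qed
  then have "[(\<Sum>a = 1..<p. int a ^ m) = (\<Sum>i<p - 1. (int g ^ m) ^ i)] (mod int p)"
    by (simp only: sum)
  moreover have "int p dvd (\<Sum>i<p - 1. (int g ^ m) ^ i)"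
  proof -
    have "[(int g ^ (p - 1)) ^ m = 1 ^ m] (mod int p)" using gp by (rule cong_pow)
    then have "int p dvd (int g ^ m) ^ (p - 1) - 1"
      by (simp add: cong_iff_dvd_diff mult.commute flip: power_mult)
    \<comment> \<open>The telescoped geometric series is divisible by \<open>p\<close>; as its
      factor \<open>g ^ m - 1\<close> is not, the sum must be.\<close>
    then have "int p dvd (int g ^ m - 1) * (\<Sum>i<p - 1. (int g ^ m) ^ i)"
      by (simp only: power_diff_1_eq)
    moreover have "\<not> int p dvd int g ^ m - 1"
    proof
      assume "int p dvd int g ^ m - 1"
      then have "[int (g ^ m) = int 1] (mod int p)" by (simp add: cong_iff_dvd_diff)
      then have "[g ^ m = 1] (mod p)" by (simp only: cong_int_iff)
      then show False using False ord ord_divides[of g m p] by simp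
    qed
    ultimately show ?thesis
      using p by (simp add: prime_dvd_mult_iff)
  qed
  ultimately show ?thesis
    using False by (simp add: cong_0_iff cong_dvd_iff)
qed

section \<open>Primes congruent to 1 modulo 4\<close>

locale prime_1_mod_4 =
  fixes p h :: nat
  assumes prime_p: "prime p" and p_eq: "p = 4 * h + 1"
begin

section \<open>The quadratic character of factorials, of 2 and of binomial coefficients\<close>

abbreviation \<chi> :: "int \<Rightarrow> int" where "\<chi> a \<equiv> Legendre a (int p)"

lemma h_pos: "h > 0"
  using prime_p p_eq by (cases h) auto

lemma p_gt_4: "p > 4"
  using h_pos p_eq by simp

lemma chi_mult: "\<chi> (a * b) = \<chi> a * \<chi> b"
  using Legendre_mult[OF prime_p] p_gt_4 by simp

lemma chi_1 [simp]: "\<chi> 1 = 1"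
  using Legendre_square[of "int p" 1] prime_p p_gt_4 by simp

lemma chi_power: "\<chi> (a ^ m) = \<chi> a ^ m"
  by (induction m) (simp_all add: chi_mult)

lemma chi_prod: "\<chi> (\<Prod>i\<in>I. f i) = (\<Prod>i\<in>I. \<chi> (f i))"
  by (induction I rule: infinite_finite_induct) (simp_all add: chi_mult)

lemma chi_cases: "\<not> int p dvd a \<Longrightarrow> \<chi> a = 1 \<or> \<chi> a = -1"
  using Legendre_cases[of a "int p"] Legendre_eq_0_iff[of a "int p"] by auto

lemma chi_mult_self: "\<not> int p dvd a \<Longrightarrow> \<chi> a * \<chi> a = 1"
  using chi_cases[of a] by auto

lemma chi_euler: "[a ^ (2 * h) = v] (mod int p) \<Longrightarrow> v \<in> {-1, 0, 1} \<Longrightarrow> \<chi> a = v"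
  using Legendre_eqI[OF prime_p, of a v] p_gt_4 p_eq by simp

text \<open>Euler's exponent \<open>2 * h\<close> is even, so -1 is a quadratic residue.\<close>

lemma chi_minus [simp]: "\<chi> (- a) = \<chi> a"
proof -
  have "\<chi> (-1) = 1" by (rule chi_euler) simp_all
  then show ?thesis using chi_mult[of "-1" a] by simp
qed

text \<open>The bases agree modulo \<open>p\<close> up to sign, which \<open>\<chi>\<close> does not
  see. Square roots may thus be compared without fixing their signs.\<close>

lemma chi_eq_if_squares_cong:
  assumes "[a ^ 2 = b ^ 2] (mod int p)"
  shows "\<chi> a = \<chi> b"
proof -
  have "int p dvd (a - b) * (a + b)"
    using assms by (simp add: cong_iff_dvd_diff algebra_simps power2_eq_square)
  then consider "int p dvd a - b" | "int p dvd a + b"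
    using prime_p by (auto simp: prime_dvd_mult_iff)
  then show ?thesis
  proof cases
    case 1
    then show ?thesis by (intro Legendre_cong) (simp add: cong_iff_dvd_diff)
  next
    case 2
    then have "\<chi> a = \<chi> (- b)" by (intro Legendre_cong) (simp add: cong_iff_dvd_diff)
    then show ?thesis by simp
  qed
qed

text \<open>Wilson's theorem is the case \<open>j = 0\<close>. Increasing \<open>j\<close> trades
  the factor \<open>p - (j + 1)\<close> for \<open>j + 1\<close>, its negative modulo
  \<open>p\<close>.\<close>

lemma fact_mult_fact_cong:
  assumes "j \<le> 4 * h"
  shows "[fact j * fact (4 * h - j) = (-1) ^ Suc j] (mod int p)"
  using assms
proof (induction j)
  case 0
  show ?case using wilson_theorem[OF prime_p] p_eq by simp
next
  case (Suc j)
  define m where "m = 4 * h - Suc j"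
  have m: "4 * h - j = Suc m" using Suc.prems by (simp add: m_def)
  have IH: "[fact j * fact (Suc m) = (-1) ^ Suc j] (mod int p)"
    using Suc m by simp
  have "fact (Suc j) * fact m + fact j * fact (Suc m) = (fact j * fact m) * (int (Suc j) + int (Suc m))"
    by (simp add: algebra_simps)
  also have "int (Suc j) + int (Suc m) = int p"
    using m Suc.prems p_eq by linarith
  finally have "[fact (Suc j) * fact m = - (fact j * fact (Suc m))] (mod int p)"
    by (simp add: cong_iff_dvd_diff)
  also have "[- (fact j * fact (Suc m)) = - ((-1) ^ Suc j)] (mod int p)"
    using IH by (simp only: cong_minus_minus_iff)
  finally show ?case by (simp add: m_def)
qed

text \<open>The middle case \<open>j = 2 * h\<close> provides an explicit square root of -1.\<close>

lemma fact_half_square_cong: "[(fact (2 * h))\<^sup>2 = -1] (mod int p)"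
  using fact_mult_fact_cong[of "2 * h"] by (simp add: power2_eq_square)

lemma not_dvd_fact: "m < p \<Longrightarrow> \<not> int p dvd fact m"
  using prime_dvd_fact_iff[OF prime_p, of m] by (metis not_le of_nat_dvd_iff of_nat_fact)

lemma not_dvd_small: "0 < m \<Longrightarrow> m < p \<Longrightarrow> \<not> int p dvd int m"
  by (auto dest: dvd_imp_le)

lemma chi_fact_half: "\<chi> (fact (2 * h)) = (-1) ^ h"
proof (rule chi_euler)
  have "[((fact (2 * h))\<^sup>2) ^ h = (-1) ^ h] (mod int p)"
    using fact_half_square_cong by (rule cong_pow)
  then show "[fact (2 * h) ^ (2 * h) = (-1) ^ h] (mod int p)"
    by (simp add: power_mult)
qed (auto simp: minus_one_power_iff)

(* If w^2 = -1 then (1 + w)^2 = 2 w. *)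
lemma chi_2: "\<chi> 2 = (-1) ^ h"
proof -
  define w :: int where "w = fact (2 * h)"
  have "[w\<^sup>2 = -1] (mod int p)" unfolding w_def by (rule fact_half_square_cong)
  then have "[1 + 2 * w + w\<^sup>2 = 1 + 2 * w + (-1)] (mod int p)"
    by (intro cong_add cong_refl)
  then have cong: "[(1 + w)\<^sup>2 = 2 * w] (mod int p)"
    by (simp add: power2_eq_square algebra_simps)
  have w: "\<not> int p dvd w" unfolding w_def by (rule not_dvd_fact) (use p_eq h_pos in simp)
  have two: "\<not> int p dvd 2" using not_dvd_small[of 2] p_gt_4 by simp
  have "\<not> int p dvd 2 * w" using w two prime_p by (simp add: prime_dvd_mult_iff)
  then have "\<not> int p dvd (1 + w)\<^sup>2" using cong_dvd_iff[OF cong] by simp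
  then have "\<not> int p dvd 1 + w" by (auto simp: power2_eq_square)
  then have "\<chi> ((1 + w)\<^sup>2) = 1" using Legendre_square prime_p by simp
  then have "\<chi> 2 * \<chi> w = 1"
    using Legendre_cong[OF cong] by (simp add: chi_mult)
  then show ?thesis
    using chi_cases[OF two] by (auto simp: w_def chi_fact_half)
qed

text \<open>Even powers take equal values at \<open>a\<close> and \<open>p - a\<close>, so the sum
  over all nonzero residues is twice this one.\<close>

lemma sum_even_powers_cong:
  "[(\<Sum>i<2 * h. ((int i + 1)\<^sup>2) ^ m) = (if 2 * h dvd m then 2 * int h else 0)] (mod int p)"
proof -
  define S where "S = (\<Sum>i<2 * h. ((int i + 1)\<^sup>2) ^ m)"
  have low: "(\<Sum>a = 1..2 * h. int a ^ (2 * m)) = S"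
  proof -
    have "(\<Sum>a = 1..2 * h. int a ^ (2 * m)) = (\<Sum>i<2 * h. int (Suc i) ^ (2 * m))"
      using sum.atLeast1_atMost_eq[of "\<lambda>a. int a ^ (2 * m)" "2 * h"] by (simp add: One_nat_def)
    then show ?thesis by (simp add: S_def power_mult add.commute)
  qed
  have "(\<Sum>a = 2 * h + 1..<p. int a ^ (2 * m)) = (\<Sum>a = 1..2 * h. int (p - a) ^ (2 * m))"
    by (rule sum.reindex_bij_witness[of _ "\<lambda>a. p - a" "\<lambda>a. p - a"]) (auto simp: p_eq)
  moreover have "[(\<Sum>a = 1..2 * h. int (p - a) ^ (2 * m)) = (\<Sum>a = 1..2 * h. int a ^ (2 * m))] (mod int p)"
  proof (rule cong_sum)
    fix a assume "a \<in> {1..2 * h}"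
    then have "int (p - a) = int p - int a" using p_eq by simp
    then have "[int (p - a) = - int a] (mod int p)" by (simp add: cong_iff_dvd_diff)
    then have "[int (p - a) ^ (2 * m) = (- int a) ^ (2 * m)] (mod int p)" by (rule cong_pow)
    then show "[int (p - a) ^ (2 * m) = int a ^ (2 * m)] (mod int p)" by simp
  qed
  ultimately have high: "[(\<Sum>a = 2 * h + 1..<p. int a ^ (2 * m)) = S] (mod int p)"
    by (simp only: low)
  have "(\<Sum>a = 1..<p. int a ^ (2 * m)) = S + (\<Sum>a = 2 * h + 1..<p. int a ^ (2 * m))"
  proof -
    have "{1..<p} = {1..2 * h} \<union> {2 * h + 1..<p}" "{1..2 * h} \<inter> {2 * h + 1..<p} = {}"
      using p_eq by auto
    then show ?thesis by (simp add: sum.union_disjoint flip: low)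
  qed
  then have "[(\<Sum>a = 1..<p. int a ^ (2 * m)) = S + S] (mod int p)"
    using high by (simp only: cong_add cong_refl)
  moreover have "p - 1 dvd 2 * m \<longleftrightarrow> 2 * h dvd m"
    using p_eq by (simp add: mult.assoc flip: mult_2_right)
  ultimately have "[S + S = (if 2 * h dvd m then -1 else 0)] (mod int p)"
    using cong_trans[OF cong_sym sum_powers_mod_prime[OF prime_p, of "2 * m"]] by (simp only:)
  \<comment> \<open>Since \<open>4 * h\<close> is -1 modulo \<open>p\<close>, the number
    \<open>2 * h\<close> plays the part of -1/2.\<close>
  moreover have "[(if 2 * h dvd m then -1 else 0) = 2 * (if 2 * h dvd m then 2 * int h else 0)] (mod int p)"
    using p_eq by (auto simp: cong_iff_dvd_diff dvd_def intro!: exI[of _ "-1"])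
  ultimately have "[2 * S = 2 * (if 2 * h dvd m then 2 * int h else 0)] (mod int p)"
    unfolding mult_2[of S] by (rule cong_trans)
  moreover have "coprime 2 (int p)"
    using p_eq by (simp add: coprime_left_2_iff_odd)
  ultimately show ?thesis
    unfolding S_def by (simp only: cong_mult_lcancel)
qed

lemma chi_2h: "\<chi> (2 * int h) = (-1) ^ h"
proof -
  have "[2 * (2 * int h) = -1] (mod int p)"
    using p_eq by (simp add: cong_iff_dvd_diff add.commute)
  then have "\<chi> 2 * \<chi> (2 * int h) = 1"
    using Legendre_cong chi_mult chi_minus chi_1 by metis
  then show ?thesis by (auto simp: chi_2 minus_one_power_iff split: if_splits)
qed

text \<open>The factorials below \<open>p\<close> have character 1 or -1, so dividing by them
  amounts to multiplying.\<close>

lemma chi_choose: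
  assumes "k \<le> m" "m < p"
  shows "\<chi> (int (m choose k)) = \<chi> (fact m) * (\<chi> (fact k) * \<chi> (fact (m - k)))"
proof -
  have "fact k * fact (m - k) * int (m choose k) = fact m"
    using arg_cong[OF binomial_fact_lemma[OF assms(1)], of int] by (simp add: of_nat_fact)
  then have "\<chi> (fact k) * \<chi> (fact (m - k)) * \<chi> (int (m choose k)) = \<chi> (fact m)"
    by (metis chi_mult)
  moreover have "\<chi> (fact k) = 1 \<or> \<chi> (fact k) = -1"
    "\<chi> (fact (m - k)) = 1 \<or> \<chi> (fact (m - k)) = -1"
    using assms by (auto intro!: chi_cases not_dvd_fact)
  ultimately show ?thesis by auto
qed

text \<open>Split \<open>fact (2 * h)\<close> into even and odd factors. Its character cancels
  against the powers of 2, because \<open>h * h\<close> and \<open>h\<close> have the same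
  parity.\<close>

lemma prod_chi_odd: "(\<Prod>i<h. \<chi> (2 * int i + 1)) = \<chi> (fact h)"
proof -
  have "\<chi> (fact (2 * h)) = \<chi> 2 ^ h * \<chi> (fact h) * (\<Prod>i<h. \<chi> (2 * int i + 1))"
    by (simp add: fact_double chi_mult chi_power chi_prod)
  moreover have "((-1) ^ h) ^ h = ((-1) ^ h :: int)"
    by (simp add: minus_one_power_iff)
  ultimately have "(-1) ^ h = (-1) ^ h * \<chi> (fact h) * (\<Prod>i<h. \<chi> (2 * int i + 1))"
    by (simp add: chi_fact_half chi_2)
  then have "\<chi> (fact h) * (\<Prod>i<h. \<chi> (2 * int i + 1)) = 1"
    by (simp add: mult.assoc)
  moreover have "\<chi> (fact h) = 1 \<or> \<chi> (fact h) = -1"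
    by (rule chi_cases[OF not_dvd_fact]) (simp add: p_eq)
  ultimately show ?thesis by auto
qed

end

section \<open>Binomial coefficients and the Pfaffian for p > 5\<close>

locale prime_1_mod_4_gt_5 = prime_1_mod_4 +
  assumes h_ge_2: "h \<ge> 2"
begin

text \<open>The value 2 would give 9, which is not prime. The resulting bound
  \<open>p \<ge> 13\<close> makes 3, 5 and 7 units modulo \<open>p\<close>.\<close>

lemma h_ge_3: "h \<ge> 3"
proof (rule ccontr)
  assume "\<not> h \<ge> 3"
  then have "h = 2" using h_ge_2 by simp
  then have "p = 3 * 3" using p_eq by simp
  then show False using prime_p by (simp add: prime_product)
qed

lemma p_ge_13: "p \<ge> 13"
  using h_ge_3 p_eq by simp

lemma chi_sq_small [simp]:
  "\<chi> 3 * \<chi> 3 = 1" "\<chi> 5 * \<chi> 5 = 1" "\<chi> 7 * \<chi> 7 = 1"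
  using not_dvd_small[of 3] not_dvd_small[of 5] not_dvd_small[of 7] p_ge_13
  by (auto intro!: chi_mult_self)

text \<open>Doubling the arguments gives \<open>p + 1\<close>, \<open>p + 3\<close> and
  \<open>p + 5\<close>.\<close>

lemma chi_double_add:
  "\<chi> (2 * int h + 1) = (-1) ^ h"
  "\<chi> (2 * int h + 2) = (-1) ^ h * \<chi> 3"
  "\<chi> (2 * int h + 3) = (-1) ^ h * \<chi> 5"
proof -
  have *: "\<chi> a = (-1) ^ h * \<chi> b" if "2 * a = int p + b" for a b
  proof -
    have "[2 * a = b] (mod int p)" using that by (simp add: cong_iff_dvd_diff)
    then have "\<chi> 2 * \<chi> a = \<chi> b" using Legendre_cong chi_mult by metis
    then show ?thesis by (auto simp: chi_2 minus_one_power_iff)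
  qed
  show "\<chi> (2 * int h + 1) = (-1) ^ h" using *[of "2 * int h + 1" 1] unfolding chi_1 by (simp add: p_eq[THEN arg_cong, of int])
  show "\<chi> (2 * int h + 2) = (-1) ^ h * \<chi> 3" by (rule *) (simp add: p_eq)
  show "\<chi> (2 * int h + 3) = (-1) ^ h * \<chi> 5" by (rule *) (simp add: p_eq)
qed

lemma chi_fact_3: "\<chi> (fact (2 * h + 3)) = \<chi> 3 * \<chi> 5"
proof -
  have "(fact (2 * h + 3) :: int) = (2 * int h + 3) * (2 * int h + 2) * (2 * int h + 1) * fact (2 * h)"
    by (simp add: eval_nat_numeral algebra_simps)
  then show ?thesis
    by (simp add: chi_mult chi_double_add chi_fact_half minus_one_power_iff)
qed

text \<open>In terms of factorials, \<open>k\<close> and \<open>2 * h + 3 - k\<close> together run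
  once through 0, ..., \<open>2 * h + 3\<close>. Grouping consecutive factorials then leaves a
  product of odd numbers.\<close>

lemma prod_chi_choose:
  "(\<Prod>k<h + 2. \<chi> (int (2 * h + 3 choose k))) = (\<chi> 3 * \<chi> 5) ^ h * \<chi> 5 * \<chi> (fact h)"
proof -
  let ?f = "\<lambda>j. \<chi> (fact j)"
  have lt: "2 * h + 3 < p" using p_eq h_ge_3 by simp
  have "(\<Prod>k<h + 2. \<chi> (int (2 * h + 3 choose k)))
      = (\<Prod>k<h + 2. \<chi> 3 * \<chi> 5 * (?f k * ?f (2 * (h + 2) - 1 - k)))"
  proof (intro prod.cong refl)
    fix k assume "k \<in> {..<h + 2}"
    then have "k \<le> 2 * h + 3" "2 * (h + 2) - 1 - k = 2 * h + 3 - k" by auto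
    then show "\<chi> (int (2 * h + 3 choose k)) = \<chi> 3 * \<chi> 5 * (?f k * ?f (2 * (h + 2) - 1 - k))"
      using chi_choose[OF _ lt] chi_fact_3 by simp
  qed
  also have "\<dots> = (\<chi> 3 * \<chi> 5) ^ (h + 2) * (\<Prod>k<2 * (h + 2). ?f k)"
    by (simp only: prod.distrib prod_constant card_lessThan prod_pair_ends[of ?f "h + 2"]
        power_mult_distrib)
  also have "(\<Prod>k<2 * (h + 2). ?f k) = (\<Prod>i<h + 2. ?f (2 * i) * ?f (2 * i + 1))"
    by (rule prod_pair_consecutive)
  \<comment> \<open>\<open>fact (2 * i) * fact (2 * i + 1)\<close> is \<open>2 * i + 1\<close> times
    a square.\<close>
  also have "\<dots> = (\<Prod>i<h + 2. \<chi> (2 * int i + 1))"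
  proof (intro prod.cong refl)
    fix i assume "i \<in> {..<h + 2}"
    then have "?f (2 * i) * ?f (2 * i) = 1"
      using lt by (intro chi_mult_self not_dvd_fact) auto
    moreover have "?f (2 * i + 1) = \<chi> (2 * int i + 1) * ?f (2 * i)"
      by (simp add: chi_mult[symmetric] add.commute)
    ultimately show "?f (2 * i) * ?f (2 * i + 1) = \<chi> (2 * int i + 1)"
      by (simp add: ac_simps)
  qed
  also have "\<dots> = \<chi> (2 * int h + 3) * \<chi> (2 * int h + 1) * (\<Prod>i<h. \<chi> (2 * int i + 1))"
    by (simp add: eval_nat_numeral algebra_simps)
  also have "\<dots> = \<chi> 5 * \<chi> (fact h)"
    by (simp add: prod_chi_odd chi_double_add minus_one_power_iff)
  finally show ?thesis
    by (simp add: power_add power2_eq_square ac_simps)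
qed

lemma choose_2_3:
  fixes N :: int defines "N \<equiv> 2 * int h + 3"
  shows "2 * int (2 * h + 3 choose 2) = N * (N - 1)"
    and "6 * int (2 * h + 3 choose 3) = N * (N - 1) * (N - 2)"
proof -
  have two: "2 * int (n choose 2) = int n * int m" if "n = Suc m" for n m
    using arg_cong[OF Suc_times_binomial[of 1 m], of int] that
    by (simp add: numeral_2_eq_2 algebra_simps)
  have three: "3 * int (n choose 3) = int n * int (m choose 2)" if "n = Suc m" for n m
    using arg_cong[OF Suc_times_binomial[of 2 m], of int] that
    by (simp add: numeral_3_eq_3 numeral_2_eq_2 algebra_simps)
  show "2 * int (2 * h + 3 choose 2) = N * (N - 1)"
    using two[of "2 * h + 3" "2 * h + 2"] by (simp add: N_def)
  have "6 * int (2 * h + 3 choose 3) = N * (2 * int (2 * h + 2 choose 2))"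
    using three[of "2 * h + 3" "2 * h + 2"] by (simp add: N_def)
  also have "2 * int (2 * h + 2 choose 2) = (N - 1) * (N - 2)"
    using two[of "2 * h + 2" "2 * h + 1"] by (simp add: N_def)
  finally show "6 * int (2 * h + 3 choose 3) = N * (N - 1) * (N - 2)" by simp
qed

lemma chi_divide:
  assumes "[a * b = c] (mod int p)" "\<chi> a * \<chi> a = 1"
  shows "\<chi> b = \<chi> a * \<chi> c"
proof -
  have "\<chi> c = \<chi> a * \<chi> b" using assms(1) Legendre_cong chi_mult by metis
  then show ?thesis using assms(2) by (simp flip: mult.assoc)
qed

lemma chi_numerals:
  "\<chi> 8 = (-1) ^ h" "\<chi> 15 = \<chi> 3 * \<chi> 5"
  "\<chi> 35 = \<chi> 5 * \<chi> 7" "\<chi> 48 = \<chi> 3" "\<chi> 63 = \<chi> 7"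
  using chi_mult[of 2 3] chi_mult[of 2 4] chi_mult[of 2 2] chi_mult[of 3 5] chi_mult[of 5 7]
    chi_mult[of 8 6] chi_mult[of 3 3] chi_mult[of 9 7]
  by (simp_all add: chi_2 minus_one_power_iff)

text \<open>With \<open>N = 2 * h + 3\<close> one has \<open>2 * N\<close> congruent to 5. Clearing
  denominators, 8 times \<open>N choose 2\<close> becomes 5 * 3 and 48 times
  \<open>N choose 3\<close> becomes 5 * 3 * 1; the merged sums give 35 and 63.\<close>

lemma chi_choose_small:
  "\<chi> (int (2 * h + 3 choose 1)) = (-1) ^ h * \<chi> 5"
  "\<chi> (int (2 * h + 3 choose 2)) = (-1) ^ h * \<chi> 3 * \<chi> 5"
  "\<chi> (int (2 * h + 3 choose 3)) = \<chi> 5"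
  "\<chi> (1 + int (2 * h + 3 choose 3)) = \<chi> 3 * \<chi> 7"
  "\<chi> (int (2 * h + 3 choose 1) + int (2 * h + 3 choose 2)) = (-1) ^ h * \<chi> 5 * \<chi> 7"
proof -
  define N where "N = 2 * int h + 3"
  have N: "2 * N = int p + 5" by (simp add: N_def p_eq)
  define P where "P = int p"
  have N2: "8 * int (2 * h + 3 choose 2) = (2 * N) * (2 * N - 2)"
    using choose_2_3(1) by (simp add: N_def algebra_simps)
  have N3: "48 * int (2 * h + 3 choose 3) = (2 * N) * (2 * N - 2) * (2 * N - 4)"
    using choose_2_3(2) by (simp add: N_def algebra_simps)
  have E2: "8 * int (2 * h + 3 choose 2) - 15 = P * (P + 8)"
    unfolding N2 N P_def by (simp add: algebra_simps)
  have E3: "48 * int (2 * h + 3 choose 3) - 15 = P * (P * P + 9 * P + 23)"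
    unfolding N3 N P_def by (simp add: algebra_simps)
  have sq: "\<chi> 8 * \<chi> 8 = 1" "\<chi> 48 * \<chi> 48 = 1"
    by (simp_all add: chi_numerals)
  show "\<chi> (int (2 * h + 3 choose 1)) = (-1) ^ h * \<chi> 5"
    using chi_double_add(3) by (simp add: add.commute)
  have C2: "[8 * int (2 * h + 3 choose 2) = 15] (mod int p)"
    unfolding cong_iff_dvd_diff E2 P_def by simp
  show "\<chi> (int (2 * h + 3 choose 2)) = (-1) ^ h * \<chi> 3 * \<chi> 5"
    using chi_divide[OF C2 sq(1)] by (simp add: chi_numerals)
  have C3: "[48 * int (2 * h + 3 choose 3) = 15] (mod int p)"
    unfolding cong_iff_dvd_diff E3 P_def by simp
  show "\<chi> (int (2 * h + 3 choose 3)) = \<chi> 5"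
    using chi_divide[OF C3 sq(2)] by (simp add: chi_numerals flip: mult.assoc)
  have "[48 + 48 * int (2 * h + 3 choose 3) = 48 + 15] (mod int p)"
    using C3 by (intro cong_add cong_refl)
  then have C3': "[48 * (1 + int (2 * h + 3 choose 3)) = 63] (mod int p)"
    by (simp add: algebra_simps)
  show "\<chi> (1 + int (2 * h + 3 choose 3)) = \<chi> 3 * \<chi> 7"
    using chi_divide[OF C3' sq(2)] by (simp add: chi_numerals)
  have "[8 * N = 20] (mod int p)"
  proof -
    have "8 * N - 20 = int p * 4" using N by simp
    then show ?thesis by (simp add: cong_iff_dvd_diff)
  qed
  then have "[8 * N + 8 * int (2 * h + 3 choose 2) = 20 + 15] (mod int p)"
    using C2 by (rule cong_add)
  then have C2': "[8 * (int (2 * h + 3 choose 1) + int (2 * h + 3 choose 2)) = 35] (mod int p)"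
    by (simp add: N_def algebra_simps)
  show "\<chi> (int (2 * h + 3 choose 1) + int (2 * h + 3 choose 2)) = (-1) ^ h * \<chi> 5 * \<chi> 7"
    using chi_divide[OF C2' sq(1)] by (simp add: chi_numerals)
qed

text \<open>Up to sign the argument is the Pfaffian of \<open>cmat\<close>. Its first two factors
  replace the binomial coefficients with \<open>k < 4\<close> in \<open>prod_chi_choose\<close>; the
  character of 7 enters twice and cancels.\<close>

lemma chi_pfaffian:
  "\<chi> ((1 + int (2 * h + 3 choose 3)) * (int (2 * h + 3 choose 1) + int (2 * h + 3 choose 2))
      * (\<Prod>k<h - 2. int (2 * h + 3 choose (k + 4))))
    = (-1) ^ h * (\<chi> 3 * \<chi> 5) ^ h * \<chi> 5 * \<chi> (fact h)"
proof -
  define X where "X = (\<Prod>k<h - 2. \<chi> (int (2 * h + 3 choose (k + 4))))"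
  have "(\<Prod>k<h + 2. \<chi> (int (2 * h + 3 choose k)))
      = (\<Prod>k<4. \<chi> (int (2 * h + 3 choose k))) * X"
  proof -
    have "h + 2 = 4 + (h - 2)" using h_ge_2 by simp
    then have "(\<Prod>k<h + 2. \<chi> (int (2 * h + 3 choose k)))
        = (\<Prod>k<4 + (h - 2). \<chi> (int (2 * h + 3 choose k)))" by simp
    also have "\<dots> = (\<Prod>k<4. \<chi> (int (2 * h + 3 choose k))) * (\<Prod>k = 4..<4 + (h - 2). \<chi> (int (2 * h + 3 choose k)))"
      by (subst prod.atLeastLessThan_concat[symmetric, of 0 4, simplified atLeast0LessThan])
         (simp_all add: atLeast0LessThan)
    also have "(\<Prod>k = 4..<4 + (h - 2). \<chi> (int (2 * h + 3 choose k))) = X"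
      using prod.shift_bounds_nat_ivl[of "\<lambda>k. \<chi> (int (2 * h + 3 choose k))" 0 4 "h - 2"]
      by (simp add: atLeast0LessThan add.commute X_def)
    finally show ?thesis .
  qed
  also have "(\<Prod>k<4. \<chi> (int (2 * h + 3 choose k))) = \<chi> 3 * \<chi> 5"
  proof -
    have "(\<Prod>k<4. \<chi> (int (2 * h + 3 choose k)))
        = \<chi> (int (2 * h + 3 choose 0)) * \<chi> (int (2 * h + 3 choose 1))
          * \<chi> (int (2 * h + 3 choose 2)) * \<chi> (int (2 * h + 3 choose 3))"
      by (simp add: eval_nat_numeral)
    also have "\<dots> = 1 * ((-1) ^ h * \<chi> 5) * ((-1) ^ h * \<chi> 3 * \<chi> 5) * \<chi> 5"
      by (simp only: chi_choose_small binomial_n_0 of_nat_1 chi_1)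
    also have "\<dots> = \<chi> 3 * \<chi> 5 * (\<chi> 5 * \<chi> 5)"
      by (auto simp: minus_one_power_iff)
    also have "\<dots> = \<chi> 3 * \<chi> 5" by simp
    finally show ?thesis .
  qed
  finally have X: "\<chi> 3 * \<chi> 5 * X = (\<chi> 3 * \<chi> 5) ^ h * \<chi> 5 * \<chi> (fact h)"
    by (simp only: prod_chi_choose)
  have "\<chi> ((1 + int (2 * h + 3 choose 3)) * (int (2 * h + 3 choose 1) + int (2 * h + 3 choose 2))
      * (\<Prod>k<h - 2. int (2 * h + 3 choose (k + 4))))
    = (\<chi> 3 * \<chi> 7) * ((-1) ^ h * \<chi> 5 * \<chi> 7) * X"
    unfolding chi_mult chi_choose_small chi_prod X_def ..
  also have "\<dots> = (-1) ^ h * (\<chi> 7 * \<chi> 7) * (\<chi> 3 * \<chi> 5 * X)"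
    by (simp only: ac_simps)
  also have "\<dots> = (-1) ^ h * ((\<chi> 3 * \<chi> 5) ^ h * \<chi> 5 * \<chi> (fact h))"
    by (simp only: chi_sq_small mult_1_right X)
  finally show ?thesis by (simp only: mult.assoc)
qed

end

section \<open>Factorization of the matrix modulo p\<close>

context prime_1_mod_4
begin

definition node :: "nat \<Rightarrow> int" where "node i = (int i + 1)\<^sup>2"

definition vmat :: "int mat" where
  "vmat = mat (2 * h) (2 * h) (\<lambda>(k, i). node i ^ k)"

lemma vmat_carrier: "vmat \<in> carrier_mat (2 * h) (2 * h)"
  by (simp add: vmat_def)

text \<open>By Fermat; hence exponents of nodes may be reduced modulo \<open>2 * h\<close>.\<close>

lemma node_power_cong_1:
  assumes "i < 2 * h"
  shows "[node i ^ (2 * h) = 1] (mod int p)"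
proof -
  have "\<not> p dvd i + 1" using assms p_eq by (auto dest: dvd_imp_le)
  then have "[(i + 1) ^ (p - 1) = 1] (mod p)" by (rule fermat_theorem[OF prime_p])
  then have "[int ((i + 1) ^ (p - 1)) = int 1] (mod int p)" by (simp only: cong_int_iff)
  then show ?thesis by (simp add: node_def p_eq add.commute flip: power_mult)
qed

(* The Gram matrix V V^T of the Vandermonde matrix is known from power sums, which gives
   det V up to sign without evaluating a product of differences. *)
lemma det_vmat_square_cong:
  "[(Determinant.det vmat)\<^sup>2 = (-1) ^ (h - 1) * (2 * int h) ^ (2 * h)] (mod int p)"
proof -
  let ?n = "2 * h" and ?q = "segment_rev 1 (2 * h - 1)"
  \<comment> \<open>\<open>?q\<close> fixes 0 and sends \<open>k > 0\<close> to
    \<open>2 * h - k\<close>, the one index below \<open>2 * h\<close> whose sum with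
    \<open>k\<close> is a multiple of \<open>2 * h\<close>.\<close>
  define G where "G = mat ?n ?n (\<lambda>(k, l). if l = ?q k then 2 * int h else 0)"
  have q: "?q permutes {0..<?n}"
    by (rule permutes_subset[OF segment_rev_permutes]) auto
  have "(?n - 1) div 2 = h - 1" using h_pos by simp
  then have detG: "Determinant.det G = (-1) ^ (h - 1) * (2 * int h) ^ (2 * h)"
    unfolding G_def by (subst det_monomial_mat[OF q]) (simp add: sign_segment_rev)
  have "(Determinant.det vmat)\<^sup>2 = Determinant.det vmat * Determinant.det (transpose_mat vmat)"
    by (simp add: det_transpose[OF vmat_carrier] power2_eq_square)
  also have "\<dots> = Determinant.det (vmat * transpose_mat vmat)"
    using vmat_carrier by (intro det_mult[symmetric]) auto
  also have "[\<dots> = Determinant.det G] (mod int p)"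
  proof (rule cong_det)
    fix k l assume kl: "k < ?n" "l < ?n"
    have "(vmat * transpose_mat vmat) $$ (k, l) = (\<Sum>i<?n. node i ^ (k + l))"
      using kl by (simp add: vmat_def scalar_prod_def power_add atLeast0LessThan)
    also have "[\<dots> = (if ?n dvd k + l then 2 * int h else 0)] (mod int p)"
      unfolding node_def by (rule sum_even_powers_cong)
    also have "?n dvd k + l \<longleftrightarrow> l = ?q k"
    proof (cases "k = 0")
      case True
      then show ?thesis using kl by (auto simp: segment_rev_def dest: dvd_imp_le)
    next
      case False
      have "?n dvd k + l \<longleftrightarrow> k + l = ?n"
      proof
        assume "?n dvd k + l"
        then obtain m where m: "k + l = ?n * m" by blast
        with kl have "?n * m < ?n * 2" by linarith
        then have "m < 2" by simp
        moreover have "m \<noteq> 0"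
        proof
          assume "m = 0"
          then show False using m False by simp
        qed
        ultimately have "m = 1" by linarith
        then show "k + l = ?n" using m by simp
      qed simp
      then show ?thesis using kl False by (auto simp: segment_rev_def)
    qed
    finally show "[(vmat * transpose_mat vmat) $$ (k, l) = G $$ (k, l)] (mod int p)"
      using kl by (simp add: G_def)
  qed (use vmat_carrier in \<open>auto simp: G_def\<close>)
  finally show ?thesis by (simp only: detG)
qed

text \<open>Writing -1 as the square of \<open>fact (2 * h)\<close> exhibits
  \<open>(det vmat)^2\<close> as the square of a product with known character.\<close>

lemma chi_det_vmat: "\<chi> (Determinant.det vmat) = (-1) ^ h"
proof -
  define w :: int where "w = fact (2 * h)"
  have "[((w\<^sup>2) ^ (h - 1)) * ((2 * int h) ^ h)\<^sup>2 = (-1) ^ (h - 1) * ((2 * int h) ^ h)\<^sup>2] (mod int p)"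
    unfolding w_def by (intro cong_mult cong_pow cong_refl fact_half_square_cong)
  moreover have "(w\<^sup>2) ^ (h - 1) * ((2 * int h) ^ h)\<^sup>2 = (w ^ (h - 1) * (2 * int h) ^ h)\<^sup>2"
    by (simp add: power_mult_distrib mult.commute flip: power_mult)
  moreover have "((2 * int h) ^ h)\<^sup>2 = (2 * int h) ^ (2 * h)"
    by (metis power_mult mult.commute)
  ultimately have "[(Determinant.det vmat)\<^sup>2 = (w ^ (h - 1) * (2 * int h) ^ h)\<^sup>2] (mod int p)"
    using det_vmat_square_cong by (metis cong_sym cong_trans)
  then have "\<chi> (Determinant.det vmat) = \<chi> (w ^ (h - 1) * (2 * int h) ^ h)"
    by (rule chi_eq_if_squares_cong)
  also have "\<dots> = ((-1) ^ h) ^ (h - 1) * ((-1) ^ h) ^ h"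
    by (simp only: chi_mult[of "fact (2 * h) ^ (h - 1)"] chi_power w_def chi_fact_half
        chi_power[of "2 * int h"] chi_2h)
  also have "\<dots> = (-1) ^ h"
    using h_pos by (cases "even h") simp_all
  finally show ?thesis .
qed

text \<open>Euler's criterion replaces the Legendre symbol by a power with exponent
  \<open>2 * h\<close>.\<close>

lemma D3_mat_cong:
  assumes "i < 2 * h" "j < 2 * h"
  shows "[D3_mat p $$ (i, j) = (node i - node j) ^ (2 * h + 3)] (mod int p)"
proof -
  have "D3_mat p $$ (i, j) = (node i - node j) ^ 3 * \<chi> (node i - node j)"
    using assms by (simp add: D3_mat_def p_eq node_def add.commute)
  also have "[\<dots> = (node i - node j) ^ 3 * (node i - node j) ^ ((p - 1) div 2)] (mod int p)"
    by (intro cong_mult cong_refl euler_criterion) (use prime_p p_gt_4 in auto)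
  also have "(node i - node j) ^ 3 * (node i - node j) ^ ((p - 1) div 2) = (node i - node j) ^ (2 * h + 3)"
    by (simp add: p_eq power_add)
  finally show ?thesis .
qed

lemma D3_mat_carrier: "D3_mat p \<in> carrier_mat (2 * h) (2 * h)"
  by (simp add: D3_mat_def p_eq)

text \<open>The cube is odd while \<open>\<chi>\<close> is even.\<close>

lemma D3_mat_skew:
  assumes "i < 2 * h" "j < 2 * h"
  shows "D3_mat p $$ (i, j) = - D3_mat p $$ (j, i)"
proof -
  have "(a - b) ^ 3 * \<chi> (a - b) = - ((b - a) ^ 3 * \<chi> (b - a))" for a b
    using chi_minus[of "b - a"] by (simp add: power3_eq_cube algebra_simps)
  from this[of "(int (i + 1))\<^sup>2" "(int (j + 1))\<^sup>2"] show ?thesis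
    using assms by (simp only: D3_mat_def p_eq index_mat case_prod_conv)
qed

text \<open>Cayley's theorem supplies the root that makes the definite description in
  \<open>int_sqrt\<close> meaningful.\<close>

lemma int_sqrt_D3_square: "(int_sqrt (D3 p))\<^sup>2 = D3 p"
proof -
  obtain x where x: "D3 p = x\<^sup>2"
    unfolding D3_def using int_det_skew_symmetric_is_square[OF D3_mat_carrier D3_mat_skew] by blast
  have "\<exists>!s. 0 \<le> s \<and> s\<^sup>2 = D3 p"
    by (rule ex1I[of _ "\<bar>x\<bar>"]) (auto simp: x power2_eq_iff)
  then have "0 \<le> int_sqrt (D3 p) \<and> (int_sqrt (D3 p))\<^sup>2 = D3 p"
    unfolding int_sqrt_def by (rule theI')
  then show ?thesis by simp
qed

text \<open>Every nonresidue among the factors contributes one sign; \<open>m < p\<close> excludes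
  the value 0.\<close>

lemma chi_fact_eq_card:
  assumes "m < p"
  shows "\<chi> (fact m) = (-1) ^ card {k \<in> {1..m}. \<chi> (int k) = -1}"
proof -
  have "\<chi> (fact m) = (\<Prod>k = 1..m. \<chi> (int k))"
    by (simp only: fact_prod of_nat_prod chi_prod)
  also have "\<dots> = (\<Prod>k = 1..m. if \<chi> (int k) = -1 then -1 else 1)"
  proof (intro prod.cong refl)
    fix k assume "k \<in> {1..m}"
    then show "\<chi> (int k) = (if \<chi> (int k) = -1 then -1 else 1)"
      using chi_cases[OF not_dvd_small[of k]] assms by auto
  qed
  also have "\<dots> = (-1) ^ card {k \<in> {1..m}. \<chi> (int k) = -1}"
    by (simp add: prod.If_cases Int_def)
  finally show ?thesis .
qed

text \<open>\<open>p / 4\<close> equals \<open>h + 1/4\<close>, so the range is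
  \<open>1, ..., h\<close>.\<close>

lemma card_nonresidues_quarter:
  "card {k :: int. 0 < k \<and> real_of_int k < real p / 4 \<and> \<chi> k = -1}
    = card {k \<in> {1..h}. \<chi> (int k) = -1}"
proof -
  have "real_of_int k < real p / 4 \<longleftrightarrow> k \<le> int h" for k
    using p_eq by linarith
  then have eq: "{k :: int. 0 < k \<and> real_of_int k < real p / 4 \<and> \<chi> k = -1}
      = {k \<in> {1..int h}. \<chi> k = -1}"
    by auto
  have "bij_betw int {k \<in> {1..h}. \<chi> (int k) = -1} {k \<in> {1..int h}. \<chi> k = -1}"
    by (rule bij_betw_byWitness[where f' = nat]) auto
  then show ?thesis unfolding eq by (rule bij_betw_same_card[symmetric])
qed

end

section \<open>The monomial coefficient matrix and the square root of the determinant\<close>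

context prime_1_mod_4_gt_5
begin

text \<open>This is the exponent of y that accompanies \<open>x ^ k\<close>:
  \<open>2 * h + 3 - k\<close> reduced modulo \<open>2 * h\<close>. The reduction splits the
  reversal into two blocks.\<close>

definition flip :: "nat \<Rightarrow> nat" where
  "flip = segment_rev 0 4 \<circ> segment_rev 4 (2 * h - 4)"

(* Exponents of x and y are reduced modulo 2 h; for k < 4 the exponents k and 2 h + k of x
   are merged. *)
definition coef :: "nat \<Rightarrow> int" where
  "coef k = (-1) ^ Suc k * (int (2 * h + 3 choose k)
     + (if k < 4 then int (2 * h + 3 choose (2 * h + k)) else 0))"

definition cmat :: "int mat" where
  "cmat = mat (2 * h) (2 * h) (\<lambda>(k, l). if l = flip k then coef k else 0)"

lemma flip_eq:
  assumes "k < 2 * h"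
  shows "flip k = (if k < 4 then 3 - k else 2 * h + 3 - k)"
proof (cases "k < 4")
  case True
  then show ?thesis by (simp add: flip_def segment_rev_def)
next
  case False
  then have "\<not> 2 * h + 3 - k < 4" using assms by arith
  then show ?thesis using False assms by (simp add: flip_def segment_rev_def add.commute)
qed

lemma flip_permutes: "flip permutes {0..<2 * h}"
  unfolding flip_def
proof (rule permutes_compose)
  show "segment_rev 4 (2 * h - 4) permutes {0..<2 * h}"
    by (rule permutes_subset[OF segment_rev_permutes]) (use h_ge_2 in auto)
  show "segment_rev 0 4 permutes {0..<2 * h}"
    by (rule permutes_subset[OF segment_rev_permutes]) (use h_ge_2 in auto)
qed

lemma flip_less: "k < 2 * h \<Longrightarrow> flip k < 2 * h"
  using permutes_in_image[OF flip_permutes, of k] by simp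

text \<open>The two blocks contribute 2 and \<open>h - 2\<close> swaps.\<close>

lemma sign_flip: "sign flip = (-1) ^ h"
proof -
  have "(2 * h - 4) div 2 = h - 2" by simp
  then show ?thesis
    unfolding flip_def using h_ge_2
    by (subst sign_compose) (simp_all add: permutation_segment_rev sign_segment_rev minus_one_power_iff)
qed

text \<open>This is the skew-symmetry of \<open>cmat\<close>. It comes from the symmetry of binomial
  coefficients and the odd exponent \<open>2 * h + 3\<close>; for \<open>k < 4\<close> the two
  merged coefficients change places.\<close>

lemma coef_flip:
  assumes "k < 2 * h"
  shows "coef (flip k) = - coef k"
proof (cases "k < 4")
  case True
  have "(2 * h + 3 choose (3 - k)) = (2 * h + 3 choose (2 * h + k))"
    using True binomial_symmetric[of "3 - k" "2 * h + 3"] by simp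
  moreover have "(2 * h + 3 choose (2 * h + (3 - k))) = (2 * h + 3 choose k)"
    using True binomial_symmetric[of k "2 * h + 3"] by simp
  moreover have "(-1) ^ Suc (3 - k) = (- ((-1) ^ Suc k) :: int)"
    using True by (auto simp: minus_one_power_iff)
  ultimately show ?thesis
    using True assms by (simp add: flip_eq coef_def algebra_simps)
next
  case False
  have "(2 * h + 3 choose (2 * h + 3 - k)) = (2 * h + 3 choose k)"
    using assms binomial_symmetric[of k "2 * h + 3"] by simp
  moreover have "(-1) ^ Suc (2 * h + 3 - k) = (- ((-1) ^ Suc k) :: int)"
    using assms by (auto simp: minus_one_power_iff)
  ultimately show ?thesis
    using False assms by (simp add: flip_eq coef_def)
qed

lemma diff_power_cong:
  fixes x y :: int
  assumes x: "[x ^ (2 * h) = 1] (mod int p)" and y: "[y ^ (2 * h) = 1] (mod int p)"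
  shows "[(x - y) ^ (2 * h + 3) = (\<Sum>k<2 * h. coef k * x ^ k * y ^ flip k)] (mod int p)"
proof -
  let ?n = "2 * h" and ?N = "2 * h + 3"
  define f where "f k = int (?N choose k) * x ^ k * (- y) ^ (?N - k)" for k
  \<comment> \<open>\<open>g\<close> holds the terms in which at most the exponent of y is reduced,
    \<open>g'\<close> the four terms in which the exponent of x is reduced.\<close>
  define g where "g k = (-1) ^ Suc k * int (?N choose k) * x ^ k * y ^ flip k" for k
  define g' where "g' k = (-1) ^ Suc k * int (?N choose (?n + k)) * x ^ k * y ^ (3 - k)" for k
  have "(x - y) ^ ?N = (\<Sum>k\<le>?N. f k)"
    using binomial_ring[of x "- y" ?N] by (simp add: f_def)
  also have "{..?N} = {..<?n + 4}" by auto
  also have "(\<Sum>k<?n + 4. f k) = (\<Sum>k<?n. f k) + (\<Sum>k<4. f (?n + k))"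
    by (simp add: eval_nat_numeral)
  finally have expand: "(x - y) ^ ?N = (\<Sum>k<?n. f k) + (\<Sum>k<4. f (?n + k))" .
  have "[f k = g k] (mod int p)" if k: "k < ?n" for k
  proof (cases "k < 4")
    case True
    then have "?N - k = ?n + (3 - k)" by simp
    then have "f k = int (?N choose k) * x ^ k * (y ^ ?n * (- y) ^ (3 - k))"
      by (simp add: f_def power_add)
    also have "[\<dots> = int (?N choose k) * x ^ k * (1 * (- y) ^ (3 - k))] (mod int p)"
      by (intro cong_mult cong_refl y)
    also have "int (?N choose k) * x ^ k * (1 * (- y) ^ (3 - k)) = g k"
    proof -
      have "(- y) ^ (3 - k) = (-1) ^ (3 - k) * y ^ (3 - k)" by (rule power_minus)
      also have "(-1) ^ (3 - k) = ((-1) ^ Suc k :: int)"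
        using True by (auto simp: minus_one_power_iff)
      finally show ?thesis using True k by (simp add: g_def flip_eq)
    qed
    finally show ?thesis .
  next
    case False
    have "(- y) ^ (?N - k) = (-1) ^ (?N - k) * y ^ (?N - k)" by (rule power_minus)
    also have "(-1) ^ (?N - k) = ((-1) ^ Suc k :: int)"
      using k by (auto simp: minus_one_power_iff)
    finally have "f k = g k" using False k by (simp add: f_def g_def flip_eq)
    then show ?thesis by simp
  qed
  then have low: "[(\<Sum>k<?n. f k) = (\<Sum>k<?n. g k)] (mod int p)"
    by (intro cong_sum) auto
  have "[f (?n + k) = g' k] (mod int p)" if k: "k < 4" for k
  proof -
    have "f (?n + k) = x ^ ?n * (int (?N choose (?n + k)) * x ^ k * (- y) ^ (3 - k))"
      by (simp add: f_def power_add)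
    also have "[\<dots> = 1 * (int (?N choose (?n + k)) * x ^ k * (- y) ^ (3 - k))] (mod int p)"
      by (intro cong_mult cong_refl x)
    also have "1 * (int (?N choose (?n + k)) * x ^ k * (- y) ^ (3 - k)) = g' k"
    proof -
      have "(- y) ^ (3 - k) = (-1) ^ (3 - k) * y ^ (3 - k)" by (rule power_minus)
      also have "(-1) ^ (3 - k) = ((-1) ^ Suc k :: int)"
        using k by (auto simp: minus_one_power_iff)
      finally show ?thesis by (simp add: g'_def)
    qed
    finally show ?thesis .
  qed
  then have high: "[(\<Sum>k<4. f (?n + k)) = (\<Sum>k<4. g' k)] (mod int p)"
    by (intro cong_sum) auto
  \<comment> \<open>By \<open>h \<ge> 2\<close> the four reduced exponents lie below
    \<open>2 * h\<close>, so one reduction suffices.\<close>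
  have "(\<Sum>k<4. g' k) = (\<Sum>k<?n. if k < 4 then g' k else 0)"
    using h_ge_2 by (intro sum.mono_neutral_cong_left) auto
  then have "(\<Sum>k<?n. g k) + (\<Sum>k<4. g' k) = (\<Sum>k<?n. coef k * x ^ k * y ^ flip k)"
    by (auto simp: sum.distrib[symmetric] g_def g'_def coef_def flip_eq algebra_simps intro!: sum.cong)
  then show ?thesis
    using cong_add[OF low high] by (simp only: expand)
qed

text \<open>Each of the \<open>h\<close> pairs \<open>k\<close>, \<open>flip k\<close> contributes
  minus a square. The representatives are 0, 1 and 4, ..., \<open>h + 1\<close>, so the squared
  product is the Pfaffian up to sign.\<close>

lemma prod_coef: "(\<Prod>k<2 * h. coef k) = (-1) ^ h * (coef 0 * coef 1 * (\<Prod>k<h - 2. coef (k + 4)))\<^sup>2"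
proof -
  have flip: "coef (flip k) = - coef k" if "k < 2 * h" for k using that by (rule coef_flip)
  have "2 * h = 4 + 2 * (h - 2)" using h_ge_2 by simp
  then have "(\<Prod>k<2 * h. coef k) = (\<Prod>k<4 + 2 * (h - 2). coef k)" by simp
  also have "\<dots> = (\<Prod>k<4. coef k) * (\<Prod>k = 4..<4 + 2 * (h - 2). coef k)"
    by (subst prod.atLeastLessThan_concat[symmetric, of 0 4, simplified atLeast0LessThan])
       (simp_all add: atLeast0LessThan)
  also have "(\<Prod>k = 4..<4 + 2 * (h - 2). coef k) = (\<Prod>k<2 * (h - 2). coef (k + 4))"
    using prod.shift_bounds_nat_ivl[of coef 0 4 "2 * (h - 2)"]
    by (simp add: atLeast0LessThan add.commute)
  also have "\<dots> = (\<Prod>k<h - 2. coef (k + 4) * coef (2 * (h - 2) - 1 - k + 4))"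
    by (rule prod_pair_ends)
  also have "\<dots> = (\<Prod>k<h - 2. - (coef (k + 4))\<^sup>2)"
  proof (intro prod.cong refl)
    fix k assume "k \<in> {..<h - 2}"
    then have "k + 4 < 2 * h" "flip (k + 4) = 2 * (h - 2) - 1 - k + 4"
      by (auto simp: flip_eq)
    then have "coef (2 * (h - 2) - 1 - k + 4) = - coef (k + 4)"
      using flip[of "k + 4"] by simp
    then show "coef (k + 4) * coef (2 * (h - 2) - 1 - k + 4) = - (coef (k + 4))\<^sup>2"
      by (simp add: power2_eq_square)
  qed
  also have "\<dots> = (\<Prod>k<h - 2. (-1) * (coef (k + 4))\<^sup>2)" by simp
  also have "\<dots> = (-1) ^ (h - 2) * (\<Prod>k<h - 2. coef (k + 4))\<^sup>2"
    by (simp only: prod.distrib prod_constant card_lessThan prod_power_distrib)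
  also have "(-1) ^ (h - 2) = ((-1) ^ h :: int)"
    using h_ge_2 by (simp add: minus_one_power_iff)
  also have "(\<Prod>k<4. coef k) = (coef 0 * coef 1)\<^sup>2"
    using flip[of 0] flip[of 1] h_ge_2
    by (simp add: flip_eq eval_nat_numeral power2_eq_square)
  finally show ?thesis by (simp add: power_mult_distrib ac_simps)
qed

lemma chi_coef: "\<chi> (coef 0 * coef 1 * (\<Prod>k<h - 2. coef (k + 4)))
    = (-1) ^ h * (\<chi> 3 * \<chi> 5) ^ h * \<chi> 5 * \<chi> (fact h)"
proof -
  have minus: "\<chi> ((-1) ^ k * a) = \<chi> a" for k a
    by (simp add: minus_one_power_iff)
  have "(2 * h + 3 choose (2 * h)) = (2 * h + 3 choose 3)"
    "(2 * h + 3 choose (2 * h + 1)) = (2 * h + 3 choose 2)"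
    using binomial_symmetric[of "2 * h" "2 * h + 3"] binomial_symmetric[of "2 * h + 1" "2 * h + 3"]
    by simp_all
  then have "\<chi> (coef 0) = \<chi> (1 + int (2 * h + 3 choose 3))"
    "\<chi> (coef 1) = \<chi> (int (2 * h + 3 choose 1) + int (2 * h + 3 choose 2))"
    "\<chi> (coef (k + 4)) = \<chi> (int (2 * h + 3 choose (k + 4)))" for k
    by (simp_all only: coef_def minus) simp_all
  then show ?thesis
    unfolding chi_pfaffian[symmetric] by (simp only: chi_mult chi_prod)
qed

text \<open>The expansion of the entries is the matrix product \<open>M\<close>, whose determinant
  is that of \<open>cmat\<close> times the square of that of \<open>vmat\<close>.\<close>

lemma D3_cong:
  "[D3 p = (Determinant.det vmat * (coef 0 * coef 1 * (\<Prod>k<h - 2. coef (k + 4))))\<^sup>2] (mod int p)"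
proof -
  let ?n = "2 * h"
  define M where "M = transpose_mat vmat * (cmat * vmat)"
  have C: "cmat \<in> carrier_mat ?n ?n" by (simp add: cmat_def)
  have M: "M \<in> carrier_mat ?n ?n" using C vmat_carrier by (auto simp: M_def)
  have CV: "(cmat * vmat) $$ (k, j) = coef k * node j ^ flip k" if "k < ?n" "j < ?n" for k j
  proof -
    have "(cmat * vmat) $$ (k, j)
        = (\<Sum>l<?n. (if l = flip k then coef k else 0) * node j ^ l)"
      using that by (simp add: cmat_def vmat_def scalar_prod_def atLeast0LessThan)
    also have "\<dots> = (\<Sum>l<?n. if l = flip k then coef k * node j ^ l else 0)"
      by (intro sum.cong) auto
    also have "\<dots> = coef k * node j ^ flip k"
      using flip_less[OF that(1)] by simp
    finally show ?thesis .
  qed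
  have entry: "M $$ (i, j) = (\<Sum>k<?n. coef k * node i ^ k * node j ^ flip k)" if "i < ?n" "j < ?n" for i j
  proof -
    have "M $$ (i, j) = (\<Sum>k<?n. node i ^ k * (cmat * vmat) $$ (k, j))"
      using that C vmat_carrier
      by (simp add: M_def scalar_prod_def atLeast0LessThan) (simp add: vmat_def)
    also have "\<dots> = (\<Sum>k<?n. coef k * node i ^ k * node j ^ flip k)"
      using that by (intro sum.cong refl) (simp add: CV)
    finally show ?thesis .
  qed
  have "[D3 p = Determinant.det M] (mod int p)"
    unfolding D3_def
  proof (rule cong_det[OF D3_mat_carrier M])
    fix i j assume "i < ?n" "j < ?n"
    then show "[D3_mat p $$ (i, j) = M $$ (i, j)] (mod int p)"
      using cong_trans[OF D3_mat_cong diff_power_cong[OF node_power_cong_1 node_power_cong_1]]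
      by (simp only: entry)
  qed
  also have "Determinant.det M = Determinant.det vmat * (Determinant.det cmat * Determinant.det vmat)"
  proof -
    have "Determinant.det M = Determinant.det (transpose_mat vmat) * Determinant.det (cmat * vmat)"
      unfolding M_def using C vmat_carrier by (intro det_mult[of _ ?n]) auto
    then show ?thesis
      using C vmat_carrier by (simp add: det_mult[of _ ?n] det_transpose[OF vmat_carrier])
  qed
  \<comment> \<open>One sign is that of \<open>flip\<close>, the other comes from the
    \<open>h\<close> pairs of coefficients; they cancel.\<close>
  also have "Determinant.det cmat = (-1) ^ h * ((-1) ^ h * (coef 0 * coef 1 * (\<Prod>k<h - 2. coef (k + 4)))\<^sup>2)"
    unfolding cmat_def det_monomial_mat[OF flip_permutes] sign_flip prod_coef by simp
  also have "\<dots> = (coef 0 * coef 1 * (\<Prod>k<h - 2. coef (k + 4)))\<^sup>2"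
    by (simp flip: mult.assoc power_add mult_2)
  finally show ?thesis by (simp add: power2_eq_square ac_simps)
qed

lemma chi_int_sqrt_D3: "\<chi> (int_sqrt (D3 p)) = \<chi> (fact h) * (\<chi> 3 * \<chi> 5) ^ h * \<chi> 5"
proof -
  have "\<chi> (int_sqrt (D3 p)) = \<chi> (Determinant.det vmat * (coef 0 * coef 1 * (\<Prod>k<h - 2. coef (k + 4))))"
    by (rule chi_eq_if_squares_cong) (simp only: int_sqrt_D3_square D3_cong)
  also have "\<dots> = (-1) ^ h * ((-1) ^ h * (\<chi> 3 * \<chi> 5) ^ h * \<chi> 5 * \<chi> (fact h))"
    by (simp only: chi_mult[of "Determinant.det vmat"] chi_det_vmat chi_coef)
  finally show ?thesis by (simp add: minus_one_power_iff)
qed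

text \<open>The reciprocity sign is 1 because \<open>(p - 1) div 2\<close> is even.\<close>

lemma chi_reciprocity:
  assumes "q \<in> {3, 5}"
  shows "\<chi> (int q) = Legendre (int p) (int q)"
proof -
  have q: "prime q" "2 < q" "p \<noteq> q" using assms p_ge_13 by auto
  have "Legendre (int p) (int q) * Legendre (int q) (int p) = (-1) ^ ((p - 1) div 2 * ((q - 1) div 2))"
    by (rule Quadratic_Reciprocity) (use q prime_p p_gt_4 in auto)
  then have "Legendre (int p) (int q) * \<chi> (int q) = 1"
    by (simp add: p_eq)
  then show ?thesis
    using Legendre_cases[of "int p" "int q"] Legendre_cases[of "int q" "int p"] by auto
qed

text \<open>For even \<open>h\<close> only the character of 5 survives, for odd \<open>h\<close>
  only that of 3, just as \<open>4 + (-1) ^ h\<close> alternates between 5 and 3.\<close>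

lemma chi_3_5: "(\<chi> 3 * \<chi> 5) ^ h * \<chi> 5 = Legendre (int p) (4 + (-1) ^ h)"
proof -
  have "(\<chi> 3 * \<chi> 5)\<^sup>2 = (\<chi> 3 * \<chi> 3) * (\<chi> 5 * \<chi> 5)"
    by (simp only: power2_eq_square ac_simps)
  then have "(\<chi> 3 * \<chi> 5)\<^sup>2 = 1" by simp
  then have "(\<chi> 3 * \<chi> 5) ^ h = (if even h then 1 else \<chi> 3 * \<chi> 5)"
    by (auto elim!: evenE oddE simp: power_mult)
  moreover have "Legendre (int p) (4 + (-1) ^ h) = (if even h then \<chi> 5 else \<chi> 3)"
    using chi_reciprocity[of 3] chi_reciprocity[of 5] by simp
  ultimately show ?thesis by (simp add: mult.assoc)
qed

end

theorem theorem1p5: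
  fixes p :: nat
  assumes "prime p" and "[p = 1] (mod 4)"
  shows "Legendre (int_sqrt (D3 p)) (int p)
       = (-1) ^ card {k :: int. 0 < k \<and> real_of_int k < real p / 4 \<and> Legendre k (int p) = -1}
         * Legendre (int p) (4 + (-1) ^ ((p - 1) div 4))"
proof -
  define h where "h = p div 4"
  have p_eq: "p = 4 * h + 1"
    using assms(2) div_mult_mod_eq[of p 4] by (simp add: h_def cong_def)
  interpret prime_1_mod_4 p h
    by unfold_locales (fact assms(1), fact p_eq)
  have card: "(-1) ^ card {k :: int. 0 < k \<and> real_of_int k < real p / 4 \<and> \<chi> k = -1} = \<chi> (fact h)"
    unfolding card_nonresidues_quarter by (rule chi_fact_eq_card[symmetric]) (simp add: p_eq)
  have h: "(p - 1) div 4 = h" by (simp add: p_eq)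
  show ?thesis
  proof (cases "h \<ge> 2")
    case True
    interpret prime_1_mod_4_gt_5 p h
      by unfold_locales (fact True)
    show ?thesis
      unfolding card h chi_int_sqrt_D3 chi_3_5[symmetric] by (simp only: mult.assoc)
  next
    case False
    then have h1: "h = 1" using h_pos by simp
    then have p5: "p = 5" by (simp add: p_eq)
    have "\<not> int p dvd 3" by (simp add: p5)
    then have chi3: "\<chi> 3 * \<chi> 3 = 1" by (rule chi_mult_self)
    have "D3_mat p \<in> carrier_mat 2 2" using D3_mat_carrier h1 by simp
    \<comment> \<open>For \<open>p = 5\<close> the nodes are 1 and 4, so the off-diagonal entries
      are \<open>27 * \<chi> 3\<close> up to sign.\<close>
    then have "D3 p = (27 * 27) * (\<chi> 3 * \<chi> 3)"
      unfolding D3_def using chi_minus[of 3]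
      by (simp add: det_mat_2 D3_mat_def p5)
    then have "(int_sqrt (D3 p))\<^sup>2 = 27\<^sup>2"
      unfolding int_sqrt_D3_square chi3 by simp
    then have "\<chi> (int_sqrt (D3 p)) = \<chi> 27"
      by (intro chi_eq_if_squares_cong) simp
    also have "\<dots> = \<chi> 2"
      by (rule Legendre_cong) (simp add: p5 cong_def)
    also have "\<dots> = -1" by (simp add: chi_2 h1)
    also have "Legendre (int p) 3 = -1"
      using Legendre_eqI[of 3 5 "-1"] by (simp add: p5 cong_def)
    then have "-1 = \<chi> (fact h) * Legendre (int p) (4 + (-1) ^ h)"
      by (simp add: h1)
    finally show ?thesis unfolding card h .
  qed
qed

end
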